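(* Let $\alpha\in BV[a,b]$ and $f\in B[a,b]$. If $f\in RDS_\alpha[a,b]$, then $f$ is Lebesgue-Stieltjes integrable on $[a,b]$ with respect to $\mu^\alpha$ and $$\int_a^b f(x)\,d\alpha=\int_{[a,b]} f(x)\,d\mu^\alpha .$$
   Context: Fix reals $a<b$. $B[a,b]$, $I[a,b]$, $BV[a,b]$ denote the bounded, the increasing (nondecreasing), and the bounded-variation real functions on $[a,b]$. $\alpha(x\pm)$ are one-sided limits, with the convention $\alpha(a-)=\alpha(a)$, $\alpha(b+)=\alpha(b)$. A partition is $\mathcal P=\{x_i\}_{i=0}^n$ with $a=x_0<\dots<x_n=b$; $I_i=(x_{i-1},x_i)$. Set $\mu_\alpha((c,d))=\alpha(d-)-\alpha(c+)$, $\mu_\alpha([c,d])=\alpha(d+)-\alpha(c-)$, $\mu_\alpha((c,d])=\alpha(d+)-\alpha(c+)$, $\mu_\alpha([c,d))=\alpha(d-)-\alpha(c-)$ and $\mu_\alpha(\{c\})=\alpha(c+)-\alpha(c-)$. A step function $u\in S[a,b]$ is a bounded function which, for some partition, equals a constant $c_i$ on each $I_i$ (values at partition points arbitrary); its integral is $\int_a^b u\,d\alpha=\sum_{i=0}^n u(x_i)\mu_\alpha(\{x_i\})+\sum_{i=1}^n c_i\mu_\alpha(I_i)$ (independent of the partition). RDS integral: for $\alpha\in I[a,b]$, $f\in B[a,b]$, let $L_\alpha(f,[a,b])=\sup\{\int_a^b v\,d\alpha: v\in S[a,b], v\le f\}$ and $U_\alpha(f,[a,b])=\inf\{\int_a^b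 u\,d\alpha: u\in S[a,b], u\ge f\}$. Write $f\in RDS_\alpha[a,b]$ if these are equal; the common value is $\int_a^b f(x)\,d\alpha$. For $\alpha\in BV[a,b]$, $f\in RDS_\alpha[a,b]$ if there is a decomposition $\alpha=\alpha^+-\alpha^-$ with $\alpha^\pm\in I[a,b]$ and $f\in RDS_{\alpha^+}[a,b]\cap RDS_{\alpha^-}[a,b]$; then $\int_a^b f\,d\alpha=\int_a^b f\,d\alpha^+-\int_a^b f\,d\alpha^-$ (independent of the decomposition). Lebesgue-Stieltjes measure: for $\alpha\in I[a,b]$, $\mu^\alpha$ is the (complete) measure on $[a,b]$ obtained from the premeasure $\mu_\alpha$ by Carathéodory extension; it agrees with $\mu_\alpha$ on intervals and singletons in $[a,b]$, and measurability of $f$ is with respect to the Carathéodory (completed Borel) $\sigma$-algebra. For $\alpha\in BV[a,b]$, let $V\alpha(x)$ be the total variation of $\alpha$ on $[a,x]$, $P\alpha=\frac12(V\alpha+\alpha-\alpha(a))$, $N\alpha=\frac12(V\alpha-\alpha+\alpha(a))$ (both increasing); then $\mu^\alpha=\mu^{P\alpha}-\mu^{N\alpha}$, and integrability with respect to $\mu^\alpha$ means integrability with respect to both $\mu^{P\alpha}$ and $\mu^{N\alpha}$, with $\int_{[a,b]} f\,d\mu^\alpha=\int_{[a,b]} f\,d\mu^{P\alpha}-\int_{[a,b]} f\,d\mu^{N\alpha}$. *)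

theory Defs
  imports "HOL-Analysis.Analysis"
begin

text \<open>A real function on \<open>[a,b]\<close> is represented by a total function of type
  \<^typ>\<open>real \<Rightarrow> real\<close>; every notion below depends only on its values on \<open>[a,b]\<close>.\<close>

subsection \<open>One-sided limits and the interval function of an integrator\<close>

definition left_lim :: "real \<Rightarrow> (real \<Rightarrow> real) \<Rightarrow> real \<Rightarrow> real" where
  "left_lim a \<alpha> x = (if x \<le> a then \<alpha> a else Lim (at_left x) \<alpha>)"

definition right_lim :: "real \<Rightarrow> (real \<Rightarrow> real) \<Rightarrow> real \<Rightarrow> real" where
  "right_lim b \<alpha> x = (if b \<le> x then \<alpha> b else Lim (at_right x) \<alpha>)"

text \<open>For a subinterval \<open>J\<close> of \<open>[a,b]\<close> with endpoints \<open>c = Inf J\<close> and \<open>d = Sup J\<close>, one formula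
  covers open, closed, half-open and one-point intervals: an endpoint belonging to \<open>J\<close>
  contributes the one-sided limit from outside \<open>J\<close>, any other endpoint the one from inside.
  The lemma after the definition lists the cases.\<close>

definition interval_mu :: "real \<Rightarrow> real \<Rightarrow> (real \<Rightarrow> real) \<Rightarrow> real set \<Rightarrow> real" where
  "interval_mu a b \<alpha> J =
    (if J = {} then 0
     else (if Sup J \<in> J then right_lim b \<alpha> (Sup J) else left_lim a \<alpha> (Sup J))
        - (if Inf J \<in> J then left_lim a \<alpha> (Inf J) else right_lim b \<alpha> (Inf J)))"

lemma interval_mu_cases:
  shows "c < d \<Longrightarrow> interval_mu a b \<alpha> {c<..<d} = left_lim a \<alpha> d - right_lim b \<alpha> c"
    and "c \<le> d \<Longrightarrow> interval_mu a b \<alpha> {c..d} = right_lim b \<alpha> d - left_lim a \<alpha> c"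
    and "c < d \<Longrightarrow> interval_mu a b \<alpha> {c<..d} = right_lim b \<alpha> d - right_lim b \<alpha> c"
    and "c < d \<Longrightarrow> interval_mu a b \<alpha> {c..<d} = left_lim a \<alpha> d - left_lim a \<alpha> c"
    and "interval_mu a b \<alpha> {c} = right_lim b \<alpha> c - left_lim a \<alpha> c"
  by (simp_all add: interval_mu_def)

subsection \<open>Partitions, step functions and the RDS integral\<close>

definition is_partition :: "real \<Rightarrow> real \<Rightarrow> nat \<Rightarrow> (nat \<Rightarrow> real) \<Rightarrow> bool" where
  "is_partition a b n x \<longleftrightarrow> x 0 = a \<and> x n = b \<and> (\<forall>i<n. x i < x (Suc i))"

text \<open>\<open>has_step_integral a b \<alpha> u s\<close>: on \<open>[a,b]\<close>, \<open>u\<close> is a step function and \<open>s\<close> is its integral,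
  computed from some partition. The value \<open>s\<close> does not depend on the partition, and
  boundedness of \<open>u\<close> on \<open>[a,b]\<close> is automatic, since \<open>u\<close> has finitely many values there.\<close>

definition has_step_integral ::
    "real \<Rightarrow> real \<Rightarrow> (real \<Rightarrow> real) \<Rightarrow> (real \<Rightarrow> real) \<Rightarrow> real \<Rightarrow> bool" where
  "has_step_integral a b \<alpha> u s \<longleftrightarrow>
    (\<exists>n x c. is_partition a b n x
      \<and> (\<forall>i<n. \<forall>t\<in>{x i<..<x (Suc i)}. u t = c i)
      \<and> s = (\<Sum>i\<le>n. u (x i) * interval_mu a b \<alpha> {x i})
          + (\<Sum>i<n. c i * interval_mu a b \<alpha> {x i<..<x (Suc i)}))"

definition lower_rds :: "real \<Rightarrow> real \<Rightarrow> (real \<Rightarrow> real) \<Rightarrow> (real \<Rightarrow> real) \<Rightarrow> real" where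
  "lower_rds a b \<alpha> f =
    Sup {s. \<exists>v. has_step_integral a b \<alpha> v s \<and> (\<forall>t\<in>{a..b}. v t \<le> f t)}"

definition upper_rds :: "real \<Rightarrow> real \<Rightarrow> (real \<Rightarrow> real) \<Rightarrow> (real \<Rightarrow> real) \<Rightarrow> real" where
  "upper_rds a b \<alpha> f =
    Inf {s. \<exists>u. has_step_integral a b \<alpha> u s \<and> (\<forall>t\<in>{a..b}. f t \<le> u t)}"

definition rds_integrable_mono :: "real \<Rightarrow> real \<Rightarrow> (real \<Rightarrow> real) \<Rightarrow> (real \<Rightarrow> real) \<Rightarrow> bool" where
  "rds_integrable_mono a b \<alpha> f \<longleftrightarrow>
    mono_on {a..b} \<alpha> \<and> bounded (f ` {a..b}) \<and> lower_rds a b \<alpha> f = upper_rds a b \<alpha> f"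

definition rds_decomposition ::
    "real \<Rightarrow> real \<Rightarrow> (real \<Rightarrow> real) \<Rightarrow> (real \<Rightarrow> real) \<Rightarrow> (real \<Rightarrow> real) \<Rightarrow> (real \<Rightarrow> real) \<Rightarrow> bool" where
  "rds_decomposition a b \<alpha> f \<alpha>p \<alpha>m \<longleftrightarrow>
    (\<forall>t\<in>{a..b}. \<alpha> t = \<alpha>p t - \<alpha>m t)
    \<and> rds_integrable_mono a b \<alpha>p f \<and> rds_integrable_mono a b \<alpha>m f"

definition rds_integrable :: "real \<Rightarrow> real \<Rightarrow> (real \<Rightarrow> real) \<Rightarrow> (real \<Rightarrow> real) \<Rightarrow> bool" where
  "rds_integrable a b \<alpha> f \<longleftrightarrow> (\<exists>\<alpha>p \<alpha>m. rds_decomposition a b \<alpha> f \<alpha>p \<alpha>m)"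

text \<open>The definite description is justified because the value does not depend on the
  decomposition.\<close>

definition rds_integral :: "real \<Rightarrow> real \<Rightarrow> (real \<Rightarrow> real) \<Rightarrow> (real \<Rightarrow> real) \<Rightarrow> real" where
  "rds_integral a b \<alpha> f =
    (THE I. \<exists>\<alpha>p \<alpha>m. rds_decomposition a b \<alpha> f \<alpha>p \<alpha>m
                   \<and> I = lower_rds a b \<alpha>p f - lower_rds a b \<alpha>m f)"

subsection \<open>Bounded variation\<close>

definition variation_sums :: "real \<Rightarrow> real \<Rightarrow> (real \<Rightarrow> real) \<Rightarrow> real set" where
  "variation_sums a b \<alpha> = {(\<Sum>i<n. \<bar>\<alpha> (x (Suc i)) - \<alpha> (x i)\<bar>) | n x. is_partition a b n x}"

definition bounded_variation :: "real \<Rightarrow> real \<Rightarrow> (real \<Rightarrow> real) \<Rightarrow> bool" where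
  "bounded_variation a b \<alpha> \<longleftrightarrow> bdd_above (variation_sums a b \<alpha>)"

text \<open>For \<open>x = a\<close> the only partition has \<open>n = 0\<close>, so the variation is \<open>0\<close> there.\<close>

definition total_variation :: "real \<Rightarrow> (real \<Rightarrow> real) \<Rightarrow> real \<Rightarrow> real" where
  "total_variation a \<alpha> x = Sup (variation_sums a x \<alpha>)"

definition pos_variation :: "real \<Rightarrow> (real \<Rightarrow> real) \<Rightarrow> real \<Rightarrow> real" where
  "pos_variation a \<alpha> x = (total_variation a \<alpha> x + \<alpha> x - \<alpha> a) / 2"

definition neg_variation :: "real \<Rightarrow> (real \<Rightarrow> real) \<Rightarrow> real \<Rightarrow> real" where
  "neg_variation a \<alpha> x = (total_variation a \<alpha> x - \<alpha> x + \<alpha> a) / 2"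

subsection \<open>Lebesgue-Stieltjes measure and integral\<close>

text \<open>For increasing \<open>\<alpha>\<close>: \<^const>\<open>extend_measure\<close> gives the extension of the premeasure from the
  subintervals of \<open>[a,b]\<close> to the Borel sets of \<open>[a,b]\<close>. It is unique, and exists by
  Caratheodory's theorem. As the measure is finite, its completion is the measure on the
  Caratheodory sigma-algebra.\<close>

definition ls_measure :: "real \<Rightarrow> real \<Rightarrow> (real \<Rightarrow> real) \<Rightarrow> real measure" where
  "ls_measure a b \<alpha> =
    completion (extend_measure {a..b} {J. is_interval J \<and> J \<subseteq> {a..b}} (\<lambda>J. J)
                  (\<lambda>J. ennreal (interval_mu a b \<alpha> J)))"

definition ls_integrable :: "real \<Rightarrow> real \<Rightarrow> (real \<Rightarrow> real) \<Rightarrow> (real \<Rightarrow> real) \<Rightarrow> bool" where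
  "ls_integrable a b \<alpha> f \<longleftrightarrow>
    integrable (ls_measure a b (pos_variation a \<alpha>)) f
    \<and> integrable (ls_measure a b (neg_variation a \<alpha>)) f"

definition ls_integral :: "real \<Rightarrow> real \<Rightarrow> (real \<Rightarrow> real) \<Rightarrow> (real \<Rightarrow> real) \<Rightarrow> real" where
  "ls_integral a b \<alpha> f =
    integral\<^sup>L (ls_measure a b (pos_variation a \<alpha>)) f
    - integral\<^sup>L (ls_measure a b (neg_variation a \<alpha>)) f"

end

theory Submission
  imports Defs
begin

text \<open>
  For an increasing integrator, the RDS integral of a step function is its Lebesgue-Stieltjes
  integral. An RDS integrable \<open>f\<close> is thus squeezed between integrable functions whose integrals
  are arbitrarily close, so it agrees almost everywhere with the supremum of a sequence of step
  functions; completeness of the measure makes it measurable, and the integrals agree.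

  For \<open>\<alpha> = \<alpha>\<^sup>+ - \<alpha>\<^sup>-\<close> of bounded variation with positive and negative variations \<open>P\<close> and \<open>N\<close>,
  the variation of \<open>\<alpha>\<close> over a subinterval is at most the increment of \<open>\<alpha>\<^sup>+ + \<alpha>\<^sup>-\<close>. Hence
  \<open>\<beta> = \<alpha>\<^sup>+ - P\<close> is increasing, with \<open>\<alpha>\<^sup>+ = P + \<beta>\<close> and \<open>\<alpha>\<^sup>- = N + \<beta> - \<alpha>(a)\<close>. RDS
  integrability passes to increasing summands and the integral is additive, so the contributions
  of \<open>\<beta>\<close> cancel: every decomposition gives the integral against \<open>P\<close> minus that against \<open>N\<close>.
\<close>

subsection \<open>One-sided limits of increasing functions\<close>

lemma mono_tendsto_at_left:
  fixes g :: "real \<Rightarrow> real"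
  assumes "mono g"
  shows "(g \<longlongrightarrow> (SUP y\<in>{..<x}. g y)) (at_left x)"
proof (rule increasing_tendsto)
  have bdd: "bdd_above (g ` {..<x})"
    by (rule bdd_aboveI[of _ "g x"]) (auto intro: monoD[OF assms])
  show "\<forall>\<^sub>F y in at_left x. g y \<le> (SUP y\<in>{..<x}. g y)"
    unfolding eventually_at_left_field by (auto intro!: exI[of _ "x - 1"] cSUP_upper bdd)
  fix l assume "l < (SUP y\<in>{..<x}. g y)"
  then obtain z where "z < x" "l < g z"
    using less_cSUP_iff[OF _ bdd] by auto
  then show "\<forall>\<^sub>F y in at_left x. l < g y"
    unfolding eventually_at_left_field
    by (intro exI[of _ z]) (blast intro: less_le_trans monoD[OF assms] less_imp_le)
qed

lemma mono_tendsto_at_right: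
  fixes g :: "real \<Rightarrow> real"
  assumes "mono g"
  shows "(g \<longlongrightarrow> (INF y\<in>{x<..}. g y)) (at_right x)"
proof (rule decreasing_tendsto)
  have bdd: "bdd_below (g ` {x<..})"
    by (rule bdd_belowI[of _ "g x"]) (auto intro: monoD[OF assms])
  show "\<forall>\<^sub>F y in at_right x. (INF y\<in>{x<..}. g y) \<le> g y"
    unfolding eventually_at_right_field by (auto intro!: exI[of _ "x + 1"] cINF_lower bdd)
  fix l assume "(INF y\<in>{x<..}. g y) < l"
  then obtain z where "x < z" "g z < l"
    using cINF_less_iff[OF _ bdd] by auto
  then show "\<forall>\<^sub>F y in at_right x. g y < l"
    unfolding eventually_at_right_field
    by (intro exI[of _ z]) (blast intro: le_less_trans monoD[OF assms] less_imp_le)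
qed

text \<open>\<open>Lim\<close> is a definite description, so it denotes the limit only once one is
  known to exist; monotonicity supplies it as a supremum.\<close>

lemma mono_tendsto_Lim_at_left:
  fixes g :: "real \<Rightarrow> real"
  assumes "mono g"
  shows "(g \<longlongrightarrow> Lim (at_left x) g) (at_left x)"
  using mono_tendsto_at_left[OF assms, of x] tendsto_Lim[of "at_left x" g] by auto

lemma mono_tendsto_Lim_at_right:
  fixes g :: "real \<Rightarrow> real"
  assumes "mono g"
  shows "(g \<longlongrightarrow> Lim (at_right x) g) (at_right x)"
  using mono_tendsto_at_right[OF assms, of x] tendsto_Lim[of "at_right x" g] by auto

lemma mono_Lim_at_right_le:
  fixes g :: "real \<Rightarrow> real"
  assumes "mono g" "x < y"
  shows "Lim (at_right x) g \<le> g y"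
proof (rule tendsto_upperbound)
  show "(g \<longlongrightarrow> Lim (at_right x) g) (at_right x)"
    using mono_tendsto_Lim_at_right[OF assms(1)] .
  show "\<forall>\<^sub>F z in at_right x. g z \<le> g y"
    unfolding eventually_at_right_field using assms by (auto intro!: exI[of _ y] monoD[OF assms(1)])
qed simp

lemma mono_le_Lim_at_right:
  fixes g :: "real \<Rightarrow> real"
  assumes "mono g" "y \<le> x"
  shows "g y \<le> Lim (at_right x) g"
proof (rule tendsto_lowerbound)
  show "(g \<longlongrightarrow> Lim (at_right x) g) (at_right x)"
    using mono_tendsto_Lim_at_right[OF assms(1)] .
  show "\<forall>\<^sub>F z in at_right x. g y \<le> g z"
    unfolding eventually_at_right_field using assms
    by (auto intro!: exI[of _ "x + 1"] monoD[OF assms(1)])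
qed simp

lemma mono_Lim_at_left_le:
  fixes g :: "real \<Rightarrow> real"
  assumes "mono g" "x \<le> y"
  shows "Lim (at_left x) g \<le> g y"
proof (rule tendsto_upperbound[OF mono_tendsto_Lim_at_left[OF assms(1)]])
  show "\<forall>\<^sub>F z in at_left x. g z \<le> g y"
    unfolding eventually_at_left_field using assms
    by (auto intro!: exI[of _ "x - 1"] monoD[OF assms(1)])
qed simp

lemma mono_le_Lim_at_left:
  fixes g :: "real \<Rightarrow> real"
  assumes "mono g" "y < x"
  shows "g y \<le> Lim (at_left x) g"
proof (rule tendsto_lowerbound[OF mono_tendsto_Lim_at_left[OF assms(1)]])
  show "\<forall>\<^sub>F z in at_left x. g y \<le> g z"
    unfolding eventually_at_left_field using assms by (auto intro!: exI[of _ y] monoD[OF assms(1)])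
qed simp

lemma mono_right_limits:
  fixes g :: "real \<Rightarrow> real"
  assumes "mono g"
  shows "mono (\<lambda>x. Lim (at_right x) g)"
proof (rule monoI)
  fix x y :: real assume "x \<le> y"
  then consider "x = y" | "x < y" by linarith
  then show "Lim (at_right x) g \<le> Lim (at_right y) g"
    by cases (auto intro: order_trans[OF mono_Lim_at_right_le mono_le_Lim_at_right] assms)
qed

text \<open>\<open>interval_measure\<close> requires an increasing right-continuous function.
  Replacing \<open>g\<close> by its right limits provides one: a bound for \<open>g\<close> on an
  interval to the right of \<open>x\<close> passes to the right limits taken there.\<close>

lemma continuous_right_limits:
  fixes g :: "real \<Rightarrow> real"
  assumes "mono g"
  shows "continuous (at_right x) (\<lambda>x. Lim (at_right x) g)"
  unfolding continuous_within
proof (rule decreasing_tendsto)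
  show "\<forall>\<^sub>F y in at_right x. Lim (at_right x) g \<le> Lim (at_right y) g"
    unfolding eventually_at_right_field
    by (auto intro!: exI[of _ "x + 1"] monoD[OF mono_right_limits[OF assms]])
  fix l assume "Lim (at_right x) g < l"
  moreover have "(g \<longlongrightarrow> Lim (at_right x) g) (at_right x)"
    using mono_tendsto_Lim_at_right[OF assms] .
  ultimately have "\<forall>\<^sub>F y in at_right x. g y < l"
    by (rule order_tendstoD(2)[rotated])
  then obtain z where "x < z" and z: "\<And>y. x < y \<Longrightarrow> y < z \<Longrightarrow> g y < l"
    unfolding eventually_at_right_field by auto
  show "\<forall>\<^sub>F y in at_right x. Lim (at_right y) g < l"
    unfolding eventually_at_right_field
  proof (intro exI[of _ z] conjI allI impI \<open>x < z\<close>)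
    fix y assume "x < y" "y < z"
    \<comment> \<open>The midpoint of \<open>y\<close> and \<open>z\<close> is a point to the right
      of \<open>y\<close> where \<open>g\<close> is still below \<open>l\<close>, and it bounds the
      right limit at \<open>y\<close>.\<close>
    then show "Lim (at_right y) g < l"
      by (intro le_less_trans[OF mono_Lim_at_right_le[OF assms, of y "(y + z) / 2"]] z) auto
  qed
qed

text \<open>For \<open>y < x\<close> one has g(y) \<le> g(y+) \<le> g(x-). Passing to right limits
  therefore keeps the left limits, and the mass of a point comes out as g(x+) - g(x-), whatever the
  value g(x).\<close>

lemma tendsto_right_limits_at_left:
  fixes g :: "real \<Rightarrow> real"
  assumes "mono g"
  shows "((\<lambda>x. Lim (at_right x) g) \<longlongrightarrow> Lim (at_left x) g) (at_left x)"
proof (rule increasing_tendsto)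
  have lim: "(g \<longlongrightarrow> Lim (at_left x) g) (at_left x)"
    using mono_tendsto_Lim_at_left[OF assms] .
  show "\<forall>\<^sub>F y in at_left x. Lim (at_right y) g \<le> Lim (at_left x) g"
    unfolding eventually_at_left_field
  proof (intro exI[of _ "x - 1"] conjI allI impI)
    fix y assume "y < x"
    show "Lim (at_right y) g \<le> Lim (at_left x) g"
    proof (rule tendsto_lowerbound[OF lim])
      show "\<forall>\<^sub>F z in at_left x. Lim (at_right y) g \<le> g z"
        unfolding eventually_at_left_field using \<open>y < x\<close>
        by (auto intro!: exI[of _ y] mono_Lim_at_right_le assms)
    qed simp
  qed simp
  fix l assume "l < Lim (at_left x) g"
  with lim have "\<forall>\<^sub>F y in at_left x. l < g y"
    by (rule order_tendstoD(1))
  then show "\<forall>\<^sub>F y in at_left x. l < Lim (at_right y) g"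
    by eventually_elim (auto intro: less_le_trans mono_le_Lim_at_right assms)
qed

subsection \<open>The measure of an interval\<close>

text \<open>The case \<open>{c<..d}\<close> is the defining property of
  \<open>interval_measure\<close>. The closed interval follows by continuity from above, and the two
  cases open on the right by removing the point \<open>d\<close>.\<close>

lemma
  fixes g :: "real \<Rightarrow> real" and c d :: real
  assumes "mono g"
  defines "M \<equiv> interval_measure (\<lambda>x. Lim (at_right x) g)"
  shows emeasure_right_limits_Ioc:
      "c \<le> d \<Longrightarrow> emeasure M {c<..d} = ennreal (Lim (at_right d) g - Lim (at_right c) g)"
    and emeasure_right_limits_Icc:
      "c \<le> d \<Longrightarrow> emeasure M {c..d} = ennreal (Lim (at_right d) g - Lim (at_left c) g)"
    and emeasure_right_limits_Ioo:
      "c < d \<Longrightarrow> emeasure M {c<..<d} = ennreal (Lim (at_left d) g - Lim (at_right c) g)"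
    and emeasure_right_limits_Ico:
      "c < d \<Longrightarrow> emeasure M {c..<d} = ennreal (Lim (at_left d) g - Lim (at_left c) g)"
proof -
  define R where "R = (\<lambda>x. Lim (at_right x) g)"
  have R_mono: "x \<le> y \<Longrightarrow> R x \<le> R y" for x y
    using mono_right_limits[OF assms(1)] by (auto simp: R_def mono_def)
  have Ioc: "emeasure M {c<..d} = ennreal (R d - R c)" if "c \<le> d" for c d
    unfolding M_def R_def[symmetric] using that
    by (intro emeasure_interval_measure_Ioc R_mono)
      (auto simp: R_def continuous_right_limits[OF assms(1)])
  then show "c \<le> d \<Longrightarrow> emeasure M {c<..d} = ennreal (Lim (at_right d) g - Lim (at_right c) g)"
    by (simp add: R_def)
  have sets_M [measurable_cong]: "sets M = sets borel"
    by (simp add: M_def)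
  \<comment> \<open>Moving the left end one unit further left gives a half-open interval that
    contains \<open>c\<close> and has finite mass.\<close>
  have fin: "emeasure M A \<noteq> \<infinity>" if "A \<subseteq> {c..d}" "c \<le> d" for A c d
  proof -
    have "emeasure M A \<le> emeasure M {c - 1<..d}"
      using that by (intro emeasure_mono) auto
    then show ?thesis
      using that Ioc[of "c - 1" d] by (auto simp: top_unique)
  qed
  have Icc: "emeasure M {c..d} = ennreal (R d - Lim (at_left c) g)" if "c \<le> d" for c d
  proof -
    \<comment> \<open>The points \<open>y n\<close> increase to \<open>c\<close> and stay strictly
      below it, so the intervals \<open>{y n<..d}\<close> decrease to \<open>{c..d}\<close>.\<close>
    define y where "y = (\<lambda>n. c - 1 / real (Suc n))"
    have y_less: "y n < c" for n by (simp add: y_def)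
    have y_mono: "y m \<le> y n" if "m \<le> n" for m n
      unfolding y_def using that by (intro diff_left_mono frac_le) simp_all
    have y: "filterlim y (at_left c) sequentially"
    proof (rule tendsto_imp_filterlim_at_left)
      show "y \<longlonglongrightarrow> c"
        using tendsto_diff[OF tendsto_const LIMSEQ_inverse_real_of_nat, of c]
        by (simp add: inverse_eq_divide y_def)
    qed (use y_less in simp)
    have "(\<lambda>n. R d - R (y n)) \<longlonglongrightarrow> R d - Lim (at_left c) g"
      unfolding R_def
      by (intro tendsto_intros filterlim_compose[OF tendsto_right_limits_at_left[OF assms(1)] y])
    moreover have "measure M {y n<..d} = R d - R (y n)" for n
    proof -
      have "y n \<le> d"
        using that y_less[of n] by linarith
      then show ?thesis
        using Ioc[of "y n" d] R_mono[of "y n" d] by (simp add: measure_def)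
    qed
    moreover have "(\<lambda>n. measure M {y n<..d}) \<longlonglongrightarrow> measure M (\<Inter>n. {y n<..d})"
    proof (rule Lim_measure_decseq)
      show "decseq (\<lambda>n. {y n<..d})"
        unfolding decseq_def
      proof (intro allI impI subsetI)
        fix m n t assume "m \<le> n" "t \<in> {y n<..d}"
        moreover note y_mono[OF \<open>m \<le> n\<close>]
        ultimately show "t \<in> {y m<..d}" by simp
      qed
      show "emeasure M {y n<..d} \<noteq> \<infinity>" for n
        using that y_less[of n] by (intro fin[of _ "y n" d]) auto
    qed auto
    moreover have "(\<Inter>n. {y n<..d}) = {c..d}"
    proof (intro set_eqI iffI)
      fix t assume t: "t \<in> (\<Inter>n. {y n<..d})"
      have "c \<le> t"
      proof (rule LIMSEQ_le_const2)
        show "y \<longlonglongrightarrow> c"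
          using y by (simp add: filterlim_at)
        show "\<exists>N. \<forall>n\<ge>N. y n \<le> t"
          using t by (auto intro!: exI[of _ 0] less_imp_le)
      qed
      with t show "t \<in> {c..d}" by auto
    next
      fix t assume "t \<in> {c..d}"
      then show "t \<in> (\<Inter>n. {y n<..d})"
        using y_less by (auto intro: less_le_trans)
    qed
    ultimately have "measure M {c..d} = R d - Lim (at_left c) g"
      by (simp add: LIMSEQ_unique)
    then show ?thesis
      using fin[of "{c..d}" c d] that by (simp add: emeasure_eq_ennreal_measure)
  qed
  then show "c \<le> d \<Longrightarrow> emeasure M {c..d} = ennreal (Lim (at_right d) g - Lim (at_left c) g)"
    by (simp add: R_def)
  \<comment> \<open>Nonnegativity of the jump allows the subtraction in \<open>ennreal\<close> below
    to be carried out in the reals.\<close>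
  have L_le_R: "Lim (at_left x) g \<le> R x" for x
  proof (rule tendsto_upperbound)
    show "((\<lambda>x. Lim (at_right x) g) \<longlongrightarrow> Lim (at_left x) g) (at_left x)"
      by (rule tendsto_right_limits_at_left[OF assms(1)])
    show "\<forall>\<^sub>F y in at_left x. Lim (at_right y) g \<le> R x"
      unfolding eventually_at_left_field
      using R_mono by (auto intro!: exI[of _ "x - 1"] simp: R_def)
  qed simp
  \<comment> \<open>The point \<open>d\<close> is the degenerate closed interval
    \<open>{d..d}\<close>, so its mass is the jump at \<open>d\<close>.\<close>
  have diff: "emeasure M (A - {d}) = emeasure M A - ennreal (R d - Lim (at_left d) g)"
    if "d \<in> A" "A \<in> sets borel" for A d
    using that Icc[of d d] by (subst emeasure_Diff) (auto simp: sets_M)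
  show "emeasure M {c<..<d} = ennreal (Lim (at_left d) g - Lim (at_right c) g)" if "c < d"
  proof -
    have "{c<..<d} = {c<..d} - {d}" by auto
    then show ?thesis
      using diff[of d "{c<..d}"] Ioc[of c d] that L_le_R[of d]
      by (simp add: ennreal_minus R_def)
  qed
  show "emeasure M {c..<d} = ennreal (Lim (at_left d) g - Lim (at_left c) g)" if "c < d"
  proof -
    have "{c..<d} = {c..d} - {d}" by auto
    then show ?thesis
      using diff[of d "{c..d}"] Icc[of c d] that L_le_R[of d]
      by (simp add: ennreal_minus R_def)
  qed
qed

subsection \<open>Increasing integrators on an interval\<close>

text \<open>Extending an integrator by its endpoint values turns the conventions
  \<open>\<alpha>(a-) = \<alpha>(a)\<close> and \<open>\<alpha>(b+) = \<alpha>(b)\<close> into genuine one-sided limits.\<close>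

definition clamped :: "real \<Rightarrow> real \<Rightarrow> (real \<Rightarrow> real) \<Rightarrow> real \<Rightarrow> real" where
  "clamped a b \<alpha> x = \<alpha> (max a (min b x))"

lemma mono_clamped:
  assumes "mono_on {a..b} \<alpha>" "a \<le> b"
  shows "mono (clamped a b \<alpha>)"
  unfolding clamped_def using assms(2) by (intro monoI mono_onD[OF assms(1)]) auto

text \<open>Both sides describe a point by the same property, so no convergence is assumed.\<close>

lemma Lim_cong_eventually:
  fixes f g :: "'a \<Rightarrow> 'b :: t2_space"
  shows
  "\<forall>\<^sub>F x in F. f x = g x \<Longrightarrow> Lim F f = Lim F g"
  using tendsto_cong[of f g F] by (simp add: t2_space_class.Lim_def)

text \<open>To the left of \<open>a\<close> the clamped function is constantly \<alpha>(a), which is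
  the convention at \<open>a\<close>; for \<open>a < x\<close> it agrees with \<alpha> just to the
  left of \<open>x\<close>.\<close>

lemma left_lim_clamped:
  assumes "a \<le> b" "x \<le> b"
  shows "left_lim a \<alpha> x = Lim (at_left x) (clamped a b \<alpha>)"
proof (cases "x \<le> a")
  case True
  then have "\<forall>\<^sub>F y in at_left x. clamped a b \<alpha> y = \<alpha> a"
    unfolding eventually_at_left_field using assms
    by (intro exI[of _ "x - 1"]) (auto simp: clamped_def)
  then have "Lim (at_left x) (clamped a b \<alpha>) = \<alpha> a"
    by (intro tendsto_Lim tendsto_eventually) auto
  with True show ?thesis by (simp add: left_lim_def)
next
  case False
  then have "\<forall>\<^sub>F y in at_left x. \<alpha> y = clamped a b \<alpha> y"
    unfolding eventually_at_left_field using assms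
    by (intro exI[of _ a]) (auto simp: clamped_def)
  with False show ?thesis by (simp add: left_lim_def Lim_cong_eventually)
qed

lemma right_lim_clamped:
  assumes "a \<le> b" "a \<le> x"
  shows "right_lim b \<alpha> x = Lim (at_right x) (clamped a b \<alpha>)"
proof (cases "b \<le> x")
  case True
  then have "\<forall>\<^sub>F y in at_right x. clamped a b \<alpha> y = \<alpha> b"
    unfolding eventually_at_right_field using assms
    by (intro exI[of _ "x + 1"]) (auto simp: clamped_def)
  then have "Lim (at_right x) (clamped a b \<alpha>) = \<alpha> b"
    by (intro tendsto_Lim tendsto_eventually) auto
  with True show ?thesis by (simp add: right_lim_def)
next
  case False
  then have "\<forall>\<^sub>F y in at_right x. \<alpha> y = clamped a b \<alpha> y"
    unfolding eventually_at_right_field using assms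
    by (intro exI[of _ b]) (auto simp: clamped_def)
  with False show ?thesis by (simp add: right_lim_def Lim_cong_eventually)
qed

text \<open>Boundedness rules out the rays and the whole line in the classification of real
  intervals, and the forms with reversed endpoints are empty.\<close>

lemma bounded_interval_cases:
  fixes J :: "real set"
  assumes "is_interval J" "J \<subseteq> {a..b}"
  obtains "J = {}" | c d where "c \<le> d" "J = {c..d}" | c d where "c < d" "J = {c<..<d}"
    | c d where "c < d" "J = {c<..d}" | c d where "c < d" "J = {c..<d}"
proof -
  have unbounded: "J \<noteq> UNIV" "J \<noteq> {..<c}" "J \<noteq> {..c}" "J \<noteq> {c<..}" "J \<noteq> {c..}" for c
  proof -
    show "J \<noteq> UNIV" using assms(2) by (metis UNIV_I atLeastAtMost_iff gt_ex not_le subsetD)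
    \<comment> \<open>The point \<open>min c a - 1\<close> lies in both rays but to the left of
      \<open>a\<close>.\<close>
    show "J \<noteq> {..<c}" "J \<noteq> {..c}"
      using subsetD[OF assms(2), of "min c a - 1"] by (cases "c \<le> a"; auto simp: min_def)+
    show "J \<noteq> {c<..}" "J \<noteq> {c..}"
      using subsetD[OF assms(2), of "max c b + 1"] by (cases "c \<le> b"; auto simp: max_def)+
  qed
  obtain c d where "J = {} \<or> J = {c<..<d} \<or> J = {c<..d} \<or> J = {c..<d} \<or> J = {c..d}"
    using interval_cases[of J] unbounded mem_is_interval_1_I[OF assms(1)] by metis
  then show thesis
    using that by (metis atLeastLessThan_empty atLeastatMost_empty greaterThanAtMost_empty
        greaterThanLessThan_empty not_le)
qed

text \<open>\<open>ennreal\<close> truncates negative numbers to zero; nonnegativity makes the value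
  of the premeasure recoverable from the extended real one.\<close>

lemma interval_mu_nonneg:
  assumes "mono_on {a..b} \<alpha>" "a \<le> b" "is_interval J" "J \<subseteq> {a..b}"
  shows "0 \<le> interval_mu a b \<alpha> J"
proof -
  note mono = mono_clamped[OF assms(1,2)]
  note [simp] = left_lim_clamped[OF assms(2)] right_lim_clamped[OF assms(2)]
  note J = assms(4)
  from assms(3,4) show ?thesis
  proof (cases rule: bounded_interval_cases)
    case 1
    then show ?thesis by (simp add: interval_mu_def)
  next
    case (2 c d)
    with J have "a \<le> c" "d \<le> b" by auto
    with 2 order_trans[OF mono_Lim_at_left_le[OF mono order_refl] mono_le_Lim_at_right[OF mono], of c d]
    show ?thesis by (simp add: interval_mu_cases)
  next
    case (3 c d)
    with J have "a \<le> c" "d \<le> b"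
      by (auto simp: greaterThanLessThan_subseteq_atLeastAtMost_iff)
    \<comment> \<open>The value at the midpoint separates the right limit at \<open>c\<close> from
      the left limit at \<open>d\<close>.\<close>
    with 3 order_trans[OF mono_Lim_at_right_le[OF mono] mono_le_Lim_at_left[OF mono],
        of c "(c + d) / 2" d]
    show ?thesis by (simp add: interval_mu_cases)
  next
    case (4 c d)
    with J have "a \<le> c" "d \<le> b"
      by (auto simp: greaterThanAtMost_subseteq_atLeastAtMost_iff)
    with 4 order_trans[OF mono_Lim_at_right_le[OF mono] mono_le_Lim_at_right[OF mono order_refl],
        of c d]
    show ?thesis by (simp add: interval_mu_cases)
  next
    case (5 c d)
    with J have "a \<le> c" "d \<le> b"
      by (auto simp: atLeastLessThan_subseteq_atLeastAtMost_iff)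
    with 5 order_trans[OF mono_Lim_at_left_le[OF mono order_refl] mono_le_Lim_at_left[OF mono],
        of c d]
    show ?thesis by (simp add: interval_mu_cases)
  qed
qed

text \<open>This exhibits a genuine Borel measure with the prescribed values on subintervals, the
  witness that the extension of the premeasure needs.\<close>

lemma emeasure_eq_interval_mu:
  assumes "mono_on {a..b} \<alpha>" "a \<le> b" "is_interval J" "J \<subseteq> {a..b}"
  shows "emeasure (interval_measure (\<lambda>x. Lim (at_right x) (clamped a b \<alpha>))) J
      = ennreal (interval_mu a b \<alpha> J)"
proof -
  note [simp] = left_lim_clamped[OF assms(2)] right_lim_clamped[OF assms(2)]
    emeasure_right_limits_Icc[OF mono_clamped[OF assms(1,2)]]
    emeasure_right_limits_Ioc[OF mono_clamped[OF assms(1,2)]]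
    emeasure_right_limits_Ico[OF mono_clamped[OF assms(1,2)]]
    emeasure_right_limits_Ioo[OF mono_clamped[OF assms(1,2)]]
  note J = assms(4)
  from assms(3,4) show ?thesis
  proof (cases rule: bounded_interval_cases)
    case 1
    then show ?thesis by (simp add: interval_mu_def)
  next
    case (2 c d)
    with J have "a \<le> c" "d \<le> b" by auto
    with 2 show ?thesis by (simp add: interval_mu_cases)
  next
    case (3 c d)
    with J have "a \<le> c" "d \<le> b"
      by (auto simp: greaterThanLessThan_subseteq_atLeastAtMost_iff)
    with 3 show ?thesis by (simp add: interval_mu_cases)
  next
    case (4 c d)
    with J have "a \<le> c" "d \<le> b"
      by (auto simp: greaterThanAtMost_subseteq_atLeastAtMost_iff)
    with 4 show ?thesis by (simp add: interval_mu_cases)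
  next
    case (5 c d)
    with J have "a \<le> c" "d \<le> b"
      by (auto simp: atLeastLessThan_subseteq_atLeastAtMost_iff)
    with 5 show ?thesis by (simp add: interval_mu_cases)
  qed
qed

text \<open>One-sided limits are additive, and the constant \<open>k\<close> cancels in the
  difference. The constant is there to absorb the normalisation of the variation functions at
  \<open>a\<close>.\<close>

lemma interval_mu_add:
  assumes "a \<le> b" and \<beta>: "mono_on {a..b} \<beta>" and \<gamma>: "mono_on {a..b} \<gamma>"
    and sum: "\<And>t. t \<in> {a..b} \<Longrightarrow> \<alpha> t = \<beta> t + \<gamma> t + k"
    and J: "J \<subseteq> {a..b}"
  shows "interval_mu a b \<alpha> J = interval_mu a b \<beta> J + interval_mu a b \<gamma> J"
proof (cases "J = {}")
  case False
  have [simp]: "clamped a b \<alpha> = (\<lambda>x. clamped a b \<beta> x + clamped a b \<gamma> x + k)"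
    unfolding clamped_def using \<open>a \<le> b\<close> by (intro ext sum) auto
  note \<beta>' = mono_clamped[OF \<beta> \<open>a \<le> b\<close>] and \<gamma>' = mono_clamped[OF \<gamma> \<open>a \<le> b\<close>]
  have left: "left_lim a \<alpha> x = left_lim a \<beta> x + left_lim a \<gamma> x + k" if "x \<le> b" for x
    using that \<open>a \<le> b\<close> unfolding left_lim_clamped[OF \<open>a \<le> b\<close> that]
    by (auto intro!: tendsto_Lim tendsto_intros mono_tendsto_Lim_at_left \<beta>' \<gamma>')
  have right: "right_lim b \<alpha> x = right_lim b \<beta> x + right_lim b \<gamma> x + k" if "a \<le> x" for x
    using that \<open>a \<le> b\<close> unfolding right_lim_clamped[OF \<open>a \<le> b\<close> that]
    by (auto intro!: tendsto_Lim tendsto_intros mono_tendsto_Lim_at_right \<beta>' \<gamma>')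
  have "a \<le> Inf J" "Sup J \<le> b"
    using J False by (auto intro!: cInf_greatest cSup_least)
  moreover have "Inf J \<le> Sup J"
    using J False by (intro cInf_le_cSup bdd_aboveI[of _ b] bdd_belowI[of _ a]) auto
  ultimately show ?thesis
    using False by (simp add: interval_mu_def left right)
qed (simp add: interval_mu_def)

subsection \<open>The Lebesgue-Stieltjes measure\<close>

lemma space_ls_measure: "space (ls_measure a b \<alpha>) = {a..b}"
  unfolding ls_measure_def by (subst space_completion, subst space_extend_measure) auto

lemma sets_ls_measure_interval:
  "is_interval J \<Longrightarrow> J \<subseteq> {a..b} \<Longrightarrow> J \<in> sets (ls_measure a b \<alpha>)"
  unfolding ls_measure_def
  by (rule sets_completionI_sets, subst sets_extend_measure) (auto intro!: sigma_sets.Basic)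

text \<open>\<open>extend_measure\<close> takes the prescribed values once some measure on the
  generated sigma-algebra does; the interval measure of the right limits is such a measure.
  Completion leaves the values on intervals unchanged.\<close>

lemma emeasure_ls_measure:
  assumes "mono_on {a..b} \<alpha>" "a \<le> b" "is_interval J" "J \<subseteq> {a..b}"
  shows "emeasure (ls_measure a b \<alpha>) J = ennreal (interval_mu a b \<alpha> J)"
proof -
  let ?S = "{J. is_interval J \<and> J \<subseteq> {a..b}}"
  let ?M = "extend_measure {a..b} ?S (\<lambda>J. J) (\<lambda>J. ennreal (interval_mu a b \<alpha> J))"
  let ?B = "interval_measure (\<lambda>x. Lim (at_right x) (clamped a b \<alpha>))"
  have sets_M: "sets ?M = sigma_sets {a..b} ?S"
    by (subst sets_extend_measure) auto
  \<comment> \<open>The generated sets are Borel, so the Borel measure \<open>?B\<close> is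
    countably additive on them.\<close>
  have borel: "A \<in> sets borel" if "A \<in> sets ?M" for A
    using that unfolding sets_M
  proof induction
    case (Basic J)
    then show ?case by (auto elim!: bounded_interval_cases)
  qed auto
  have "emeasure ?M J = ennreal (interval_mu a b \<alpha> J)"
  proof (rule emeasure_extend_measure[OF refl, where \<mu>' = "emeasure ?B"])
    show "emeasure ?B J = ennreal (interval_mu a b \<alpha> J)" if "J \<in> ?S" for J
      using that assms(1,2) by (auto intro: emeasure_eq_interval_mu)
    show "positive (sets ?M) (emeasure ?B)"
      by (simp add: positive_def)
    show "countably_additive (sets ?M) (emeasure ?B)"
      unfolding countably_additive_def
      by (auto intro!: suminf_emeasure borel simp: image_subset_iff)
  qed (use assms in auto)
  moreover have "J \<in> sets ?M"
    using assms unfolding sets_M by (auto intro: sigma_sets.Basic)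
  ultimately show ?thesis
    by (simp add: ls_measure_def)
qed

lemma measure_ls_measure:
  assumes "mono_on {a..b} \<alpha>" "a \<le> b" "is_interval J" "J \<subseteq> {a..b}"
  shows "measure (ls_measure a b \<alpha>) J = interval_mu a b \<alpha> J"
  using emeasure_ls_measure[OF assms] interval_mu_nonneg[OF assms] by (simp add: measure_def)

lemma complete_measure_ls_measure: "complete_measure (ls_measure a b \<alpha>)"
  unfolding ls_measure_def by (rule completion.complete_measure_axioms)

subsection \<open>Step functions and the RDS integral for increasing integrators\<close>

lemma is_partition_mono:
  assumes "is_partition a b n x" "i \<le> j" "j \<le> n"
  shows "x i \<le> x j"
  using assms(2,3)
proof (induction rule: dec_induct)
  case (step j)
  then have "x j < x (Suc j)"
    using assms(1) by (simp add: is_partition_def)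
  with step show ?case by simp
qed simp

lemma is_partition_mem:
  assumes "is_partition a b n x" "i \<le> n"
  shows "x i \<in> {a..b}"
  using assms is_partition_mono[OF assms(1), of 0 i] is_partition_mono[OF assms(1), of i n]
  by (auto simp: is_partition_def)

text \<open>Induction over the cells: \<open>{a..x (Suc m)}\<close> is the disjoint union of
  \<open>{a..x m}\<close>, the next open cell and its right endpoint.\<close>

lemma step_function_decomposition:
  fixes u :: "real \<Rightarrow> real"
  assumes part: "is_partition a b n x" and const: "\<forall>i<n. \<forall>t\<in>{x i<..<x (Suc i)}. u t = c i"
  shows "m \<le> n \<Longrightarrow> u t * indicator {a..x m} t =
    (\<Sum>i\<le>m. u (x i) * indicator {x i} t) + (\<Sum>i<m. c i * indicator {x i<..<x (Suc i)} t)"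
proof (induction m)
  case 0
  have "x 0 = a" using part by (simp add: is_partition_def)
  then show ?case by (auto simp: indicator_def)
next
  case (Suc m)
  have less: "a \<le> x m" "x m < x (Suc m)"
    using part Suc.prems is_partition_mem[OF part, of m] by (auto simp: is_partition_def)
  then have "indicator {a..x (Suc m)} t = indicator {a..x m} t
      + indicator {x m<..<x (Suc m)} t + (indicator {x (Suc m)} t :: real)"
    by (auto simp: indicator_def)
  moreover have "u t * indicator {x m<..<x (Suc m)} t = c m * indicator {x m<..<x (Suc m)} t"
    using const Suc.prems by (auto simp: indicator_def)
  moreover have "u t * indicator {x (Suc m)} t = u (x (Suc m)) * indicator {x (Suc m)} t"
    by (auto simp: indicator_def)
  ultimately show ?case
    using Suc by (simp only: distrib_left sum.lessThan_Suc sum.atMost_Suc Suc_leD)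
qed

text \<open>Integrate the decomposition into indicators term by term; each point and open cell has
  mass \<open>interval_mu\<close>. In particular \<open>s\<close> does not depend on the
  partition.\<close>

lemma has_bochner_integral_step:
  assumes "mono_on {a..b} \<alpha>" "a \<le> b" "has_step_integral a b \<alpha> u s"
  shows "has_bochner_integral (ls_measure a b \<alpha>) u s"
proof -
  obtain n x c where part: "is_partition a b n x"
    and const: "\<forall>i<n. \<forall>t\<in>{x i<..<x (Suc i)}. u t = c i"
    and s: "s = (\<Sum>i\<le>n. u (x i) * interval_mu a b \<alpha> {x i})
          + (\<Sum>i<n. c i * interval_mu a b \<alpha> {x i<..<x (Suc i)})"
    using assms(3) unfolding has_step_integral_def by blast
  let ?M = "ls_measure a b \<alpha>"
  have ind: "has_bochner_integral ?M (\<lambda>t. k * indicator J t) (k * interval_mu a b \<alpha> J)"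
    if "is_interval J" "J \<subseteq> {a..b}" for k J
    using has_bochner_integral_real_indicator[of J ?M] that
    by (intro has_bochner_integral_mult_right)
      (simp add: sets_ls_measure_interval emeasure_ls_measure measure_ls_measure assms(1,2))
  have "has_bochner_integral ?M
      (\<lambda>t. (\<Sum>i\<le>n. u (x i) * indicator {x i} t) + (\<Sum>i<n. c i * indicator {x i<..<x (Suc i)} t)) s"
    unfolding s
  proof (intro has_bochner_integral_add has_bochner_integral_sum ind)
    fix i assume "i \<in> {..n}"
    then show "{x i} \<subseteq> {a..b}" using is_partition_mem[OF part] by auto
  next
    fix i assume "i \<in> {..<n}"
    then show "{x i<..<x (Suc i)} \<subseteq> {a..b}"
      using is_partition_mem[OF part, of i] is_partition_mem[OF part, of "Suc i"] by auto
  qed (auto simp: is_interval_1)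
  moreover have "u t = (\<Sum>i\<le>n. u (x i) * indicator {x i} t)
      + (\<Sum>i<n. c i * indicator {x i<..<x (Suc i)} t)" if "t \<in> {a..b}" for t
  proof -
    have "x n = b" using part by (simp add: is_partition_def)
    with that show ?thesis
      using step_function_decomposition[OF part const order_refl, of t] by simp
  qed
  ultimately show ?thesis
    by (subst has_bochner_integral_cong[OF refl _ refl]) (auto simp: space_ls_measure)
qed

text \<open>Comparing Lebesgue-Stieltjes integrals avoids a common refinement of the two
  partitions.\<close>

lemma step_integral_mono:
  assumes "mono_on {a..b} \<alpha>" "a \<le> b"
    and "has_step_integral a b \<alpha> v s" "has_step_integral a b \<alpha> u t"
    and "\<And>x. x \<in> {a..b} \<Longrightarrow> v x \<le> u x"
  shows "s \<le> t"
  using has_bochner_integral_step[OF assms(1,2,3)] has_bochner_integral_step[OF assms(1,2,4)]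
    assms(5) integral_mono[of "ls_measure a b \<alpha>" v u]
  by (auto simp: has_bochner_integral_iff space_ls_measure)

lemma has_step_integral_const:
  assumes "a < b"
  shows "\<exists>s. has_step_integral a b \<alpha> (\<lambda>_. k) s"
  unfolding has_step_integral_def is_partition_def using assms
  by (intro exI[of _ 1] exI[of _ "\<lambda>i. if i = 0 then a else b"] exI[of _ "\<lambda>_. k"] exI) auto

text \<open>The partition and the values of \<open>u\<close> stay the same; only the weights of
  points and cells split.\<close>

lemma has_step_integral_add:
  assumes "a \<le> b" "mono_on {a..b} \<beta>" "mono_on {a..b} \<gamma>"
    and "\<And>t. t \<in> {a..b} \<Longrightarrow> \<alpha> t = \<beta> t + \<gamma> t + k"
    and "has_step_integral a b \<alpha> u s"
  obtains p q where "has_step_integral a b \<beta> u p" "has_step_integral a b \<gamma> u q" "s = p + q"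
proof -
  obtain n x c where part: "is_partition a b n x"
    and const: "\<forall>i<n. \<forall>t\<in>{x i<..<x (Suc i)}. u t = c i"
    and s: "s = (\<Sum>i\<le>n. u (x i) * interval_mu a b \<alpha> {x i})
          + (\<Sum>i<n. c i * interval_mu a b \<alpha> {x i<..<x (Suc i)})"
    using assms(5) unfolding has_step_integral_def by blast
  define S where "S \<delta> = (\<Sum>i\<le>n. u (x i) * interval_mu a b \<delta> {x i})
      + (\<Sum>i<n. c i * interval_mu a b \<delta> {x i<..<x (Suc i)})" for \<delta>
  note add = interval_mu_add[OF assms(1-4)]
  have "interval_mu a b \<alpha> {x i} = interval_mu a b \<beta> {x i} + interval_mu a b \<gamma> {x i}"
    if "i \<le> n" for i
    using that is_partition_mem[OF part, of i] by (intro add) auto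
  moreover have "interval_mu a b \<alpha> {x i<..<x (Suc i)}
      = interval_mu a b \<beta> {x i<..<x (Suc i)} + interval_mu a b \<gamma> {x i<..<x (Suc i)}"
    if "i < n" for i
    using that is_partition_mem[OF part, of i] is_partition_mem[OF part, of "Suc i"]
    by (intro add) auto
  ultimately have "S \<alpha> = S \<beta> + S \<gamma>"
    by (simp add: S_def distrib_left sum.distrib)
  then have "s = S \<beta> + S \<gamma>"
    by (simp add: S_def s)
  moreover have "has_step_integral a b \<delta> u (S \<delta>)" for \<delta>
    unfolding has_step_integral_def S_def using part const by blast
  ultimately show thesis
    using that by blast
qed

section \<open>Lower and upper RDS integrals\<close>

lemma step_bounds_exist:
  assumes "a < b" "bounded (f ` {a..b})"
  obtains v u s t where "has_step_integral a b \<alpha> v s" "has_step_integral a b \<alpha> u t"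
    "\<forall>x\<in>{a..b}. v x \<le> f x" "\<forall>x\<in>{a..b}. f x \<le> u x"
proof -
  obtain K where K: "\<And>x. x \<in> {a..b} \<Longrightarrow> \<bar>f x\<bar> \<le> K"
    using assms(2) unfolding bounded_iff by (metis image_eqI real_norm_def)
  obtain s t where "has_step_integral a b \<alpha> (\<lambda>_. - K) s" "has_step_integral a b \<alpha> (\<lambda>_. K) t"
    using has_step_integral_const[OF assms(1)] by metis
  moreover have "\<forall>x\<in>{a..b}. - K \<le> f x" "\<forall>x\<in>{a..b}. f x \<le> K"
    using K by (simp_all add: abs_le_iff minus_le_iff)
  ultimately show thesis by (rule that)
qed

text \<open>Suprema and infima of reals are informative only for nonempty bounded sets. Constant
  step functions make both sets nonempty, and each lower step integral is at most each upper
  one.\<close>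

lemma
  assumes "a < b" "mono_on {a..b} \<alpha>" "bounded (f ` {a..b})"
  shows step_le_lower_rds:
      "has_step_integral a b \<alpha> v s \<Longrightarrow> \<forall>x\<in>{a..b}. v x \<le> f x \<Longrightarrow> s \<le> lower_rds a b \<alpha> f"
    and upper_rds_le_step:
      "has_step_integral a b \<alpha> u t \<Longrightarrow> \<forall>x\<in>{a..b}. f x \<le> u x \<Longrightarrow> upper_rds a b \<alpha> f \<le> t"
    and lower_rds_le_upper_rds: "lower_rds a b \<alpha> f \<le> upper_rds a b \<alpha> f"
    and less_lower_rdsD: "y < lower_rds a b \<alpha> f \<Longrightarrow>
      \<exists>v s. has_step_integral a b \<alpha> v s \<and> (\<forall>x\<in>{a..b}. v x \<le> f x) \<and> y < s"
    and upper_rds_lessD: "upper_rds a b \<alpha> f < y \<Longrightarrow>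
      \<exists>u t. has_step_integral a b \<alpha> u t \<and> (\<forall>x\<in>{a..b}. f x \<le> u x) \<and> t < y"
proof -
  let ?L = "{s. \<exists>v. has_step_integral a b \<alpha> v s \<and> (\<forall>t\<in>{a..b}. v t \<le> f t)}"
  let ?U = "{s. \<exists>u. has_step_integral a b \<alpha> u s \<and> (\<forall>t\<in>{a..b}. f t \<le> u t)}"
  have le: "s \<le> t" if st: "s \<in> ?L" "t \<in> ?U" for s t
  proof -
    obtain v u where v: "has_step_integral a b \<alpha> v s" "\<forall>x\<in>{a..b}. v x \<le> f x"
      and u: "has_step_integral a b \<alpha> u t" "\<forall>x\<in>{a..b}. f x \<le> u x"
      using st by blast
    have "v x \<le> u x" if "x \<in> {a..b}" for x
      using u(2) v(2) that by (blast intro: order_trans)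
    then show "s \<le> t"
      using step_integral_mono[OF assms(2) less_imp_le[OF assms(1)] v(1) u(1)] by blast
  qed
  obtain v0 u0 s0 t0 where "has_step_integral a b \<alpha> v0 s0" "has_step_integral a b \<alpha> u0 t0"
    "\<forall>x\<in>{a..b}. v0 x \<le> f x" "\<forall>x\<in>{a..b}. f x \<le> u0 x"
    using step_bounds_exist[OF assms(1,3), of \<alpha>] by metis
  then have mem: "s0 \<in> ?L" "t0 \<in> ?U" by blast+
  then have ne: "?L \<noteq> {}" "?U \<noteq> {}" by blast+
  have bdd: "bdd_above ?L" "bdd_below ?U"
    by (rule bdd_aboveI[of _ t0], erule le[OF _ mem(2)])
      (rule bdd_belowI[of _ s0], erule le[OF mem(1)])
  show "has_step_integral a b \<alpha> v s \<Longrightarrow> \<forall>x\<in>{a..b}. v x \<le> f x \<Longrightarrow> s \<le> lower_rds a b \<alpha> f"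
    unfolding lower_rds_def by (rule cSup_upper) (use bdd in auto)
  show "has_step_integral a b \<alpha> u t \<Longrightarrow> \<forall>x\<in>{a..b}. f x \<le> u x \<Longrightarrow> upper_rds a b \<alpha> f \<le> t"
    unfolding upper_rds_def by (rule cInf_lower) (use bdd in auto)
  show "lower_rds a b \<alpha> f \<le> upper_rds a b \<alpha> f"
    unfolding lower_rds_def upper_rds_def
    by (intro cSup_least cInf_greatest ne) (rule le)
  show "y < lower_rds a b \<alpha> f \<Longrightarrow>
      \<exists>v s. has_step_integral a b \<alpha> v s \<and> (\<forall>x\<in>{a..b}. v x \<le> f x) \<and> y < s"
    unfolding lower_rds_def less_cSup_iff[OF ne(1) bdd(1)] by blast
  show "upper_rds a b \<alpha> f < y \<Longrightarrow>
      \<exists>u t. has_step_integral a b \<alpha> u t \<and> (\<forall>x\<in>{a..b}. f x \<le> u x) \<and> t < y"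
    unfolding upper_rds_def cInf_less_iff[OF ne(2) bdd(2)] by blast
qed

text \<open>One half of the Darboux criterion: approximate the common value within
  \<open>e / 2\<close> from either side.\<close>

lemma rds_integrable_monoD:
  assumes "a < b" "rds_integrable_mono a b \<alpha> f" "e > 0"
  obtains v s u t where "has_step_integral a b \<alpha> v s" "has_step_integral a b \<alpha> u t"
    "\<forall>x\<in>{a..b}. v x \<le> f x" "\<forall>x\<in>{a..b}. f x \<le> u x" "t - s < e"
proof -
  let ?I = "lower_rds a b \<alpha> f"
  have \<alpha>: "mono_on {a..b} \<alpha>" and f: "bounded (f ` {a..b})" and I: "upper_rds a b \<alpha> f = ?I"
    using assms(2) by (auto simp: rds_integrable_mono_def)
  obtain v s where v: "has_step_integral a b \<alpha> v s" "\<forall>x\<in>{a..b}. v x \<le> f x" "?I - e / 2 < s"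
    using less_lower_rdsD[OF assms(1) \<alpha> f, of "?I - e / 2"] \<open>e > 0\<close> by auto
  obtain u t where u: "has_step_integral a b \<alpha> u t" "\<forall>x\<in>{a..b}. f x \<le> u x" "t < ?I + e / 2"
    using upper_rds_lessD[OF assms(1) \<alpha> f, of "?I + e / 2"] \<open>e > 0\<close> I by auto
  have "t - s < e" using u(3) v(3) by linarith
  with u v show thesis using that by blast
qed

lemma rds_integrable_monoI:
  assumes "a < b" "mono_on {a..b} \<alpha>" "bounded (f ` {a..b})"
    and "\<And>e. e > 0 \<Longrightarrow> \<exists>v s u t. has_step_integral a b \<alpha> v s \<and> has_step_integral a b \<alpha> u t
      \<and> (\<forall>x\<in>{a..b}. v x \<le> f x) \<and> (\<forall>x\<in>{a..b}. f x \<le> u x) \<and> t - s < e"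
  shows "rds_integrable_mono a b \<alpha> f"
proof -
  have "upper_rds a b \<alpha> f \<le> lower_rds a b \<alpha> f + e" if e: "e > 0" for e
  proof -
    obtain v s u t where "has_step_integral a b \<alpha> v s" "has_step_integral a b \<alpha> u t"
        "\<forall>x\<in>{a..b}. v x \<le> f x" "\<forall>x\<in>{a..b}. f x \<le> u x" "t - s < e"
      using assms(4)[OF e] by blast
    then show ?thesis
      using step_le_lower_rds[OF assms(1-3), of v s] upper_rds_le_step[OF assms(1-3), of u t]
      by linarith
  qed
  then have "upper_rds a b \<alpha> f \<le> lower_rds a b \<alpha> f"
    by (rule field_le_epsilon)
  with lower_rds_le_upper_rds[OF assms(1-3)] assms(2,3) show ?thesis
    by (simp add: rds_integrable_mono_def)
qed

text \<open>For steps \<open>v\<close> below and \<open>u\<close> above \<open>f\<close>, the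
  \<alpha>-gap is the sum of the \<beta>-gap and the \<gamma>-gap. Both are nonnegative, so each is
  small when the sum is.\<close>

lemma rds_integrable_mono_split:
  assumes "a < b" "mono_on {a..b} \<beta>" "mono_on {a..b} \<gamma>"
    and sum: "\<And>t. t \<in> {a..b} \<Longrightarrow> \<alpha> t = \<beta> t + \<gamma> t + k"
    and rds: "rds_integrable_mono a b \<alpha> f"
  shows "rds_integrable_mono a b \<beta> f"
    and "lower_rds a b \<alpha> f = lower_rds a b \<beta> f + lower_rds a b \<gamma> f"
proof -
  have \<alpha>: "mono_on {a..b} \<alpha>" and f: "bounded (f ` {a..b})"
      and eq: "upper_rds a b \<alpha> f = lower_rds a b \<alpha> f"
    using rds by (auto simp: rds_integrable_mono_def)
  have split: "\<exists>v u p q p' q'. has_step_integral a b \<beta> v p \<and> has_step_integral a b \<gamma> v q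
      \<and> has_step_integral a b \<beta> u p' \<and> has_step_integral a b \<gamma> u q'
      \<and> (\<forall>x\<in>{a..b}. v x \<le> f x) \<and> (\<forall>x\<in>{a..b}. f x \<le> u x)
      \<and> p' + q' - (p + q) < e \<and> p \<le> p' \<and> q \<le> q'
      \<and> p + q \<le> lower_rds a b \<alpha> f \<and> lower_rds a b \<alpha> f \<le> p' + q'" if e: "e > 0" for e
  proof -
    obtain v s u t where v: "has_step_integral a b \<alpha> v s" "\<forall>x\<in>{a..b}. v x \<le> f x"
      and u: "has_step_integral a b \<alpha> u t" "\<forall>x\<in>{a..b}. f x \<le> u x" and st: "t - s < e"
      using rds_integrable_monoD[OF assms(1) rds e] by metis
    obtain p q where p: "has_step_integral a b \<beta> v p" "has_step_integral a b \<gamma> v q" "s = p + q"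
      using has_step_integral_add[OF less_imp_le[OF assms(1)] assms(2,3) sum v(1)] by blast
    obtain p' q' where p': "has_step_integral a b \<beta> u p'" "has_step_integral a b \<gamma> u q'" "t = p' + q'"
      using has_step_integral_add[OF less_imp_le[OF assms(1)] assms(2,3) sum u(1)] by blast
    have vu: "v x \<le> u x" if "x \<in> {a..b}" for x
      using u(2) v(2) that by (blast intro: order_trans)
    have "p \<le> p'" "q \<le> q'"
      using step_integral_mono[OF assms(2) less_imp_le[OF assms(1)] p(1) p'(1) vu]
        step_integral_mono[OF assms(3) less_imp_le[OF assms(1)] p(2) p'(2) vu]
      by simp_all
    moreover have "s \<le> lower_rds a b \<alpha> f" "lower_rds a b \<alpha> f \<le> t"
      using step_le_lower_rds[OF assms(1) \<alpha> f v] upper_rds_le_step[OF assms(1) \<alpha> f u] eq by auto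
    ultimately show ?thesis
      using u(2) v(2) p p' st by blast
  qed
  have \<beta>': "rds_integrable_mono a b \<beta> f"
  proof (rule rds_integrable_monoI[OF assms(1,2) f])
    fix e :: real assume "e > 0"
    from split[OF this] obtain v u p q p' q' where
      "has_step_integral a b \<beta> v p" "has_step_integral a b \<beta> u p'"
      "\<forall>x\<in>{a..b}. v x \<le> f x" "\<forall>x\<in>{a..b}. f x \<le> u x" "p' + q' - (p + q) < e" "q \<le> q'"
      by blast
    moreover then have "p' - p < e" by linarith
    ultimately show "\<exists>v s u t. has_step_integral a b \<beta> v s \<and> has_step_integral a b \<beta> u t
      \<and> (\<forall>x\<in>{a..b}. v x \<le> f x) \<and> (\<forall>x\<in>{a..b}. f x \<le> u x) \<and> t - s < e"
      by blast
  qed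
  then show "rds_integrable_mono a b \<beta> f" .
  \<comment> \<open>The same argument with the summands exchanged; it bounds the lower integral for
    \<gamma> by upper step integrals below.\<close>
  have \<gamma>': "rds_integrable_mono a b \<gamma> f"
  proof (rule rds_integrable_monoI[OF assms(1,3) f])
    fix e :: real assume "e > 0"
    from split[OF this] obtain v u p q p' q' where
      "has_step_integral a b \<gamma> v q" "has_step_integral a b \<gamma> u q'"
      "\<forall>x\<in>{a..b}. v x \<le> f x" "\<forall>x\<in>{a..b}. f x \<le> u x" "p' + q' - (p + q) < e" "p \<le> p'"
      by blast
    moreover then have "q' - q < e" by linarith
    ultimately show "\<exists>v s u t. has_step_integral a b \<gamma> v s \<and> has_step_integral a b \<gamma> u t
      \<and> (\<forall>x\<in>{a..b}. v x \<le> f x) \<and> (\<forall>x\<in>{a..b}. f x \<le> u x) \<and> t - s < e"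
      by blast
  qed
  \<comment> \<open>Both quantities lie between \<open>p + q\<close> and \<open>p' + q'\<close>,
    which are less than \<open>e\<close> apart.\<close>
  have close: "\<bar>lower_rds a b \<alpha> f - (lower_rds a b \<beta> f + lower_rds a b \<gamma> f)\<bar> \<le> e"
    if e_pos: "e > 0" for e
  proof -
    from split[OF e_pos] obtain v u p q p' q' where
      *: "has_step_integral a b \<beta> v p" "has_step_integral a b \<gamma> v q"
        "has_step_integral a b \<beta> u p'" "has_step_integral a b \<gamma> u q'"
        "\<forall>x\<in>{a..b}. v x \<le> f x" "\<forall>x\<in>{a..b}. f x \<le> u x"
      and e: "p' + q' - (p + q) < e"
        "p + q \<le> lower_rds a b \<alpha> f" "lower_rds a b \<alpha> f \<le> p' + q'"
      by blast
    have "p \<le> lower_rds a b \<beta> f" "q \<le> lower_rds a b \<gamma> f"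
      using step_le_lower_rds[OF assms(1,2) f *(1,5)] step_le_lower_rds[OF assms(1,3) f *(2,5)]
      by auto
    moreover have "lower_rds a b \<beta> f \<le> p'" "lower_rds a b \<gamma> f \<le> q'"
      using upper_rds_le_step[OF assms(1,2) f *(3,6)] upper_rds_le_step[OF assms(1,3) f *(4,6)]
        \<beta>' \<gamma>' by (auto simp: rds_integrable_mono_def)
    ultimately show ?thesis using e by linarith
  qed
  show "lower_rds a b \<alpha> f = lower_rds a b \<beta> f + lower_rds a b \<gamma> f"
  proof -
    have "\<bar>lower_rds a b \<alpha> f - (lower_rds a b \<beta> f + lower_rds a b \<gamma> f)\<bar> \<le> 0"
    proof (rule field_le_epsilon)
      fix e :: real assume "e > 0"
      from close[OF this]
      show "\<bar>lower_rds a b \<alpha> f - (lower_rds a b \<beta> f + lower_rds a b \<gamma> f)\<bar> \<le> 0 + e"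
        by simp
    qed
    then show ?thesis by simp
  qed
qed

subsection \<open>Squeezing between integrable functions\<close>

text \<open>Preimages under \<open>f\<close> and \<open>g\<close> differ by a subset of a null set,
  which a complete measure makes measurable.\<close>

lemma (in complete_measure) borel_measurable_AE_eq:
  fixes f g :: "'a \<Rightarrow> real"
  assumes "g \<in> borel_measurable M" "AE x in M. f x = g x"
  shows "f \<in> borel_measurable M"
proof (rule measurableI)
  fix A :: "real set" assume "A \<in> sets borel"
  show "f -` A \<inter> space M \<in> sets M"
  proof (rule in_sets_AE)
    show "AE x in M. x \<in> g -` A \<inter> space M \<longleftrightarrow> x \<in> f -` A \<inter> space M"
      using assms(2) by eventually_elim auto
    show "g -` A \<inter> space M \<in> sets M"
      using assms(1) \<open>A \<in> sets borel\<close> by (rule measurable_sets)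
  qed auto
qed simp

text \<open>With \<open>g\<close> the supremum of the lower and \<open>h\<close> the infimum of the
  upper functions for a sequence of gaps tending to 0, \<open>h - g\<close> is nonnegative with
  integral 0. Hence \<open>g\<close> and \<open>h\<close>, and \<open>f\<close> between them, agree
  almost everywhere.\<close>

lemma (in complete_measure) integrable_squeeze:
  fixes f :: "'a \<Rightarrow> real"
  assumes "\<And>e. e > 0 \<Longrightarrow> \<exists>v u. integrable M v \<and> integrable M u
    \<and> (\<forall>x\<in>space M. v x \<le> f x \<and> f x \<le> u x) \<and> integral\<^sup>L M u - integral\<^sup>L M v < e"
  shows "integrable M f"
proof -
  have "\<forall>n. \<exists>v u. integrable M v \<and> integrable M u
    \<and> (\<forall>x\<in>space M. v x \<le> f x \<and> f x \<le> u x) \<and> integral\<^sup>L M u - integral\<^sup>L M v < inverse (real (Suc n))"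
    by (intro allI assms) simp
  then obtain v u where [simp]: "\<And>n. integrable M (v n)" "\<And>n. integrable M (u n)"
    and v: "\<And>n x. x \<in> space M \<Longrightarrow> v n x \<le> f x" and u: "\<And>n x. x \<in> space M \<Longrightarrow> f x \<le> u n x"
    and less: "\<And>n. integral\<^sup>L M (u n) - integral\<^sup>L M (v n) < inverse (real (Suc n))"
    by metis
  define g where "g x = (SUP n. v n x)" for x
  define h where "h x = (INF n. u n x)" for x
  \<comment> \<open>The value \<open>f x\<close> bounds both families pointwise, so the real-valued
    supremum and infimum are genuine and inherit measurability.\<close>
  have bdd: "bdd_above (range (\<lambda>n. v n x))" "bdd_below (range (\<lambda>n. u n x))" if "x \<in> space M" for x
    using u[OF that] v[OF that] by (auto intro!: bdd_aboveI[of _ "f x"] bdd_belowI[of _ "f x"])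
  have [measurable]: "v n \<in> borel_measurable M" "u n \<in> borel_measurable M" for n
    by (simp_all add: borel_measurable_integrable)
  have [measurable]: "g \<in> borel_measurable M" "h \<in> borel_measurable M"
    unfolding g_def h_def using bdd by simp_all
  have gf: "g x \<le> f x" and fh: "f x \<le> h x" if "x \<in> space M" for x
    unfolding g_def h_def using u v that by (auto intro: cSUP_least cINF_greatest)
  have vg: "v n x \<le> g x" and hu: "h x \<le> u n x" if "x \<in> space M" for n x
    unfolding g_def h_def using bdd[OF that] by (auto intro: cSUP_upper cINF_lower)
  have diff: "0 \<le> h x - g x" "h x - g x \<le> u n x - v n x" if "x \<in> space M" for n x
    using gf[OF that] fh[OF that] vg[OF that, of n] hu[OF that, of n] by linarith+
  have int: "integrable M (\<lambda>x. h x - g x)"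
  proof (rule Bochner_Integration.integrable_bound)
    show "integrable M (\<lambda>x. u 0 x - v 0 x)" by simp
    show "AE x in M. norm (h x - g x) \<le> norm (u 0 x - v 0 x)"
    proof (rule AE_I2)
      fix x assume "x \<in> space M"
      from diff(1)[OF this] diff(2)[OF this, of 0]
      show "norm (h x - g x) \<le> norm (u 0 x - v 0 x)" by simp
    qed
  qed simp
  have "integral\<^sup>L M (\<lambda>x. h x - g x) \<le> inverse (real (Suc n))" for n
  proof -
    have "integral\<^sup>L M (\<lambda>x. h x - g x) \<le> integral\<^sup>L M (\<lambda>x. u n x - v n x)"
      by (intro integral_mono int) (auto intro: diff)
    then show ?thesis using less[of n] by simp
  qed
  then have "integral\<^sup>L M (\<lambda>x. h x - g x) \<le> 0"
    by (intro LIMSEQ_le_const[OF LIMSEQ_inverse_real_of_nat]) auto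
  moreover have "0 \<le> integral\<^sup>L M (\<lambda>x. h x - g x)"
    by (intro integral_nonneg_AE AE_I2 diff)
  ultimately have "AE x in M. h x - g x = 0"
    using integral_nonneg_eq_0_iff_AE[OF int] diff(1) by (simp add: AE_I2)
  then have "AE x in M. f x = g x"
    using AE_space by eventually_elim (use gf fh in force)
  then have "f \<in> borel_measurable M"
    by (rule borel_measurable_AE_eq[rotated]) simp
  \<comment> \<open>Measurability being settled, integrability follows by domination from
    \<open>v 0\<close> \<le> \<open>f\<close> \<le> \<open>u 0\<close>.\<close>
  show ?thesis
  proof (rule Bochner_Integration.integrable_bound)
    show "integrable M (\<lambda>x. \<bar>u 0 x\<bar> + \<bar>v 0 x\<bar>)" by simp
    show "AE x in M. norm (f x) \<le> norm (\<bar>u 0 x\<bar> + \<bar>v 0 x\<bar>)"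
    proof (rule AE_I2)
      fix x assume "x \<in> space M"
      from u[OF this, of 0] v[OF this, of 0]
      show "norm (f x) \<le> norm (\<bar>u 0 x\<bar> + \<bar>v 0 x\<bar>)" by simp
    qed
  qed fact
qed

text \<open>Step functions enclosing \<open>f\<close> serve as the integrable bounds of the squeeze.
  The RDS value and the integral of \<open>f\<close> then both lie between the same step integrals,
  whose gap is arbitrarily small.\<close>

lemma has_bochner_integral_rds:
  assumes "a < b" "rds_integrable_mono a b \<alpha> f"
  shows "has_bochner_integral (ls_measure a b \<alpha>) f (lower_rds a b \<alpha> f)"
proof -
  let ?M = "ls_measure a b \<alpha>" and ?I = "lower_rds a b \<alpha> f"
  have \<alpha>: "mono_on {a..b} \<alpha>" and f: "bounded (f ` {a..b})" and eq: "upper_rds a b \<alpha> f = ?I"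
    using assms(2) by (auto simp: rds_integrable_mono_def)
  interpret complete_measure ?M by (rule complete_measure_ls_measure)
  have step: "integrable ?M u" "integral\<^sup>L ?M u = s" if "has_step_integral a b \<alpha> u s" for u s
    using has_bochner_integral_step[OF \<alpha> less_imp_le[OF assms(1)] that]
    by (auto simp: has_bochner_integral_iff)
  have int: "integrable ?M f"
  proof (rule integrable_squeeze)
    fix e :: real assume "e > 0"
    with assms obtain v s u t where "has_step_integral a b \<alpha> v s" "has_step_integral a b \<alpha> u t"
        "\<forall>x\<in>{a..b}. v x \<le> f x" "\<forall>x\<in>{a..b}. f x \<le> u x" "t - s < e"
      by (rule rds_integrable_monoD)
    then show "\<exists>v u. integrable ?M v \<and> integrable ?M u
        \<and> (\<forall>x\<in>space ?M. v x \<le> f x \<and> f x \<le> u x) \<and> integral\<^sup>L ?M u - integral\<^sup>L ?M v < e"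
      by (intro exI[of _ v] exI[of _ u]) (auto simp: step space_ls_measure)
  qed
  have "?I \<le> integral\<^sup>L ?M f + e" "integral\<^sup>L ?M f \<le> ?I + e" if e: "e > 0" for e
  proof -
    from assms e obtain v s u t where v: "has_step_integral a b \<alpha> v s" "\<forall>x\<in>{a..b}. v x \<le> f x"
      and u: "has_step_integral a b \<alpha> u t" "\<forall>x\<in>{a..b}. f x \<le> u x" and "t - s < e"
      by (rule rds_integrable_monoD)
    moreover have "s \<le> integral\<^sup>L ?M f" "integral\<^sup>L ?M f \<le> t"
      using u v integral_mono[of ?M v f] integral_mono[of ?M f u] int
      by (auto simp: step space_ls_measure)
    moreover have "s \<le> ?I" "?I \<le> t"
      using step_le_lower_rds[OF assms(1) \<alpha> f v] upper_rds_le_step[OF assms(1) \<alpha> f u] eq by auto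
    ultimately show "?I \<le> integral\<^sup>L ?M f + e" "integral\<^sup>L ?M f \<le> ?I + e"
      by linarith+
  qed
  then have "?I \<le> integral\<^sup>L ?M f" "integral\<^sup>L ?M f \<le> ?I"
    by (blast intro: field_le_epsilon)+
  with int show ?thesis
    by (simp add: has_bochner_integral_iff)
qed

subsection \<open>The variation functions\<close>

lemma is_partition_snoc:
  assumes "is_partition a x n p" "x < y"
  shows "is_partition a y (Suc n) (p(Suc n := y))"
  using assms by (auto simp: is_partition_def less_Suc_eq)

lemma variation_sum_snoc:
  fixes \<alpha> :: "real \<Rightarrow> real"
  assumes "is_partition a x n p"
  shows "(\<Sum>i<Suc n. \<bar>\<alpha> ((p(Suc n := y)) (Suc i)) - \<alpha> ((p(Suc n := y)) i)\<bar>)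
    = (\<Sum>i<n. \<bar>\<alpha> (p (Suc i)) - \<alpha> (p i)\<bar>) + \<bar>\<alpha> y - \<alpha> x\<bar>"
  using assms by (simp add: is_partition_def)

text \<open>Append \<open>y\<close> to the partition. When \<open>x = y\<close> nothing can be
  appended, since partitions are strictly increasing, but then the added term is 0.\<close>

lemma variation_sums_snoc:
  assumes "s \<in> variation_sums a x \<alpha>" "x \<le> y"
  shows "s + \<bar>\<alpha> y - \<alpha> x\<bar> \<in> variation_sums a y \<alpha>"
proof (cases "x = y")
  case False
  obtain n p where p: "is_partition a x n p" and s: "s = (\<Sum>i<n. \<bar>\<alpha> (p (Suc i)) - \<alpha> (p i)\<bar>)"
    using assms(1) unfolding variation_sums_def by blast
  from is_partition_snoc[OF p, of y] variation_sum_snoc[OF p, of \<alpha> y] False assms(2) show ?thesis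
    unfolding variation_sums_def s by (intro CollectI exI[of _ "Suc n"] exI) (auto simp del: sum.lessThan_Suc)
qed (use assms in simp)

lemma variation_sums_refl: "0 \<in> variation_sums a a \<alpha>"
  unfolding variation_sums_def is_partition_def
  by (intro CollectI exI[of _ 0] exI[of _ "\<lambda>_. a"]) simp

lemma variation_sums_nonempty: "a \<le> x \<Longrightarrow> variation_sums a x \<alpha> \<noteq> {}"
  using variation_sums_snoc[OF variation_sums_refl, of a x \<alpha>] by blast

lemma bdd_above_variation_sums:
  assumes "bounded_variation a b \<alpha>" "x \<le> b"
  shows "bdd_above (variation_sums a x \<alpha>)"
proof -
  obtain K where K: "\<And>s. s \<in> variation_sums a b \<alpha> \<Longrightarrow> s \<le> K"
    using assms(1) by (auto simp: bounded_variation_def bdd_above_def)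
  show ?thesis
  proof (rule bdd_aboveI)
    fix s assume "s \<in> variation_sums a x \<alpha>"
    from K[OF variation_sums_snoc[OF this assms(2)]] show "s \<le> K" by simp
  qed
qed

lemma total_variation_increment_ge:
  assumes "bounded_variation a b \<alpha>" "a \<le> x" "x \<le> y" "y \<le> b"
  shows "\<bar>\<alpha> y - \<alpha> x\<bar> \<le> total_variation a \<alpha> y - total_variation a \<alpha> x"
proof -
  have "total_variation a \<alpha> x \<le> total_variation a \<alpha> y - \<bar>\<alpha> y - \<alpha> x\<bar>"
    unfolding total_variation_def
  proof (rule cSup_least)
    fix s assume "s \<in> variation_sums a x \<alpha>"
    from cSup_upper[OF variation_sums_snoc[OF this assms(3)]
        bdd_above_variation_sums[OF assms(1,4)]]
    show "s \<le> Sup (variation_sums a y \<alpha>) - \<bar>\<alpha> y - \<alpha> x\<bar>" by simp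
  qed (rule variation_sums_nonempty[OF assms(2)])
  then show ?thesis by simp
qed

text \<open>Cut the partition at \<open>x\<close>: the part before \<open>x\<close>, closed off at
  \<open>x\<close>, gives a sum on \<open>{a..x}\<close>, while the increments beyond
  \<open>x\<close> are dominated by those of \<open>w\<close>, which telescope. The induction
  removes the last point.\<close>

lemma variation_sum_restrict:
  assumes "\<And>s t. a \<le> s \<Longrightarrow> s \<le> t \<Longrightarrow> t \<le> b \<Longrightarrow> \<bar>\<alpha> t - \<alpha> s\<bar> \<le> w t - w s"
    and "is_partition a y n p" "a \<le> x" "x \<le> y" "y \<le> b"
  shows "\<exists>s\<in>variation_sums a x \<alpha>. (\<Sum>i<n. \<bar>\<alpha> (p (Suc i)) - \<alpha> (p i)\<bar>) \<le> s + w y - w x"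
  using assms(2-5)
proof (induction n arbitrary: y)
  case 0
  then have "x = a" "y = a" by (auto simp: is_partition_def)
  then show ?case using variation_sums_refl[of a \<alpha>] by force
next
  case (Suc n)
  let ?z = "p n"
  have part: "is_partition a ?z n p" and z: "?z < y" and y: "p (Suc n) = y"
    using Suc.prems(1) by (auto simp: is_partition_def)
  have az: "a \<le> ?z"
    using is_partition_mem[OF part order_refl] by simp
  show ?case
  proof (cases "x \<le> ?z")
    case True
    with Suc.IH[OF part Suc.prems(2)] z Suc.prems(4) obtain s where s: "s \<in> variation_sums a x \<alpha>"
      "(\<Sum>i<n. \<bar>\<alpha> (p (Suc i)) - \<alpha> (p i)\<bar>) \<le> s + w ?z - w x"
      by auto
    have "\<bar>\<alpha> y - \<alpha> ?z\<bar> \<le> w y - w ?z"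
      using assms(1)[of ?z y] az z Suc.prems(4) by simp
    with s(2) show ?thesis
      by (intro bexI[OF _ s(1)]) (simp add: y)
  next
    \<comment> \<open>Here \<open>x\<close> lies in the last cell. The triangle inequality splits
      the last increment at \<open>x\<close>; its first half completes a sum on
      \<open>{a..x}\<close>.\<close>
    case False
    let ?s = "(\<Sum>i<n. \<bar>\<alpha> (p (Suc i)) - \<alpha> (p i)\<bar>)"
    have "?s \<in> variation_sums a ?z \<alpha>"
      unfolding variation_sums_def using part by blast
    with False have mem: "?s + \<bar>\<alpha> x - \<alpha> ?z\<bar> \<in> variation_sums a x \<alpha>"
      by (intro variation_sums_snoc) auto
    have "\<bar>\<alpha> y - \<alpha> x\<bar> \<le> w y - w x"
      using assms(1)[of x y] Suc.prems by simp
    then show ?thesis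
      by (intro bexI[OF _ mem]) (simp add: y)
  qed
qed

text \<open>The variation over a subinterval is at most the increment of any \<open>w\<close>
  dominating the increments of \<alpha>: restrict each sum up to \<open>y\<close> and take the
  supremum.\<close>

lemma total_variation_increment_le:
  assumes "\<And>s t. a \<le> s \<Longrightarrow> s \<le> t \<Longrightarrow> t \<le> b \<Longrightarrow> \<bar>\<alpha> t - \<alpha> s\<bar> \<le> w t - w s"
    and "bounded_variation a b \<alpha>" "a \<le> x" "x \<le> y" "y \<le> b"
  shows "total_variation a \<alpha> y - total_variation a \<alpha> x \<le> w y - w x"
proof -
  have "total_variation a \<alpha> y \<le> total_variation a \<alpha> x + w y - w x"
    unfolding total_variation_def
  proof (rule cSup_least)
    show "variation_sums a y \<alpha> \<noteq> {}"
      using assms by (intro variation_sums_nonempty) simp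
    fix s assume "s \<in> variation_sums a y \<alpha>"
    then obtain n p where p: "is_partition a y n p"
      and s: "s = (\<Sum>i<n. \<bar>\<alpha> (p (Suc i)) - \<alpha> (p i)\<bar>)"
      unfolding variation_sums_def by blast
    from variation_sum_restrict[of a b \<alpha> w, OF assms(1) p assms(3-5)]
    obtain s' where "s' \<in> variation_sums a x \<alpha>" "s \<le> s' + w y - w x"
      unfolding s by blast
    moreover from this(1) have "s' \<le> Sup (variation_sums a x \<alpha>)"
      using assms by (intro cSup_upper bdd_above_variation_sums[of a b]) auto
    ultimately show "s \<le> Sup (variation_sums a x \<alpha>) + w y - w x" by linarith
  qed
  then show ?thesis by simp
qed

section \<open>Minimality of the Jordan decomposition and the comparison of integrals\<close>

lemma mono_on_variations:
  assumes "bounded_variation a b \<alpha>"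
  shows "mono_on {a..b} (pos_variation a \<alpha>)" "mono_on {a..b} (neg_variation a \<alpha>)"
proof -
  have "\<bar>\<alpha> y - \<alpha> x\<bar> \<le> total_variation a \<alpha> y - total_variation a \<alpha> x"
    if "x \<in> {a..b}" "y \<in> {a..b}" "x \<le> y" for x y
    using that by (intro total_variation_increment_ge[OF assms]) auto
  then show "mono_on {a..b} (pos_variation a \<alpha>)" "mono_on {a..b} (neg_variation a \<alpha>)"
    unfolding pos_variation_def neg_variation_def
    by (auto intro!: mono_onI simp: abs_le_iff) (smt (verit) atLeastAtMost_iff)+
qed

text \<open>The function \<open>\<alpha>p + \<alpha>m\<close> dominates the increments of \<alpha>,
  hence those of its total variation. Adding the increment of \<open>\<alpha>p - \<alpha>m\<close>
  and halving bounds the increment of the positive variation by that of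
  \<open>\<alpha>p\<close>.\<close>

lemma mono_on_diff_pos_variation:
  assumes "bounded_variation a b \<alpha>" "mono_on {a..b} \<alpha>p" "mono_on {a..b} \<alpha>m"
    and "\<forall>t\<in>{a..b}. \<alpha> t = \<alpha>p t - \<alpha>m t"
  shows "mono_on {a..b} (\<lambda>t. \<alpha>p t - pos_variation a \<alpha> t)"
proof (rule mono_onI)
  fix x y assume xy: "x \<in> {a..b}" "y \<in> {a..b}" "x \<le> y"
  have "\<bar>\<alpha> t - \<alpha> s\<bar> \<le> (\<alpha>p t + \<alpha>m t) - (\<alpha>p s + \<alpha>m s)" if "a \<le> s" "s \<le> t" "t \<le> b" for s t
    using mono_onD[OF assms(2), of s t] mono_onD[OF assms(3), of s t] assms(4) that by auto
  from total_variation_increment_le[of a b \<alpha> "\<lambda>t. \<alpha>p t + \<alpha>m t" x y, OF this assms(1)] xy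
  have "total_variation a \<alpha> y - total_variation a \<alpha> x \<le> (\<alpha>p y + \<alpha>m y) - (\<alpha>p x + \<alpha>m x)"
    by simp
  moreover have "\<alpha> x = \<alpha>p x - \<alpha>m x" "\<alpha> y = \<alpha>p y - \<alpha>m y"
    using xy assms(4) by auto
  ultimately show "\<alpha>p x - pos_variation a \<alpha> x \<le> \<alpha>p y - pos_variation a \<alpha> y"
    by (simp add: pos_variation_def field_simps)
qed

lemma rds_decomposition_variations:
  assumes "a < b" "bounded_variation a b \<alpha>" "rds_decomposition a b \<alpha> f \<alpha>p \<alpha>m"
  shows "rds_integrable_mono a b (pos_variation a \<alpha>) f"
    and "rds_integrable_mono a b (neg_variation a \<alpha>) f"
    and "lower_rds a b \<alpha>p f - lower_rds a b \<alpha>m f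
      = lower_rds a b (pos_variation a \<alpha>) f - lower_rds a b (neg_variation a \<alpha>) f"
proof -
  have dec: "\<forall>t\<in>{a..b}. \<alpha> t = \<alpha>p t - \<alpha>m t"
    and rds: "rds_integrable_mono a b \<alpha>p f" "rds_integrable_mono a b \<alpha>m f"
    using assms(3) by (auto simp: rds_decomposition_def)
  let ?\<beta> = "\<lambda>t. \<alpha>p t - pos_variation a \<alpha> t"
  have \<beta>: "mono_on {a..b} ?\<beta>"
    using rds by (intro mono_on_diff_pos_variation[OF assms(2) _ _ dec])
      (simp_all add: rds_integrable_mono_def)
  note mono = mono_on_variations[OF assms(2)]
  have p: "\<alpha>p t = pos_variation a \<alpha> t + ?\<beta> t + 0" for t by simp
  \<comment> \<open>The positive minus the negative variation is \<alpha> - \<alpha>(a), which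
    accounts for the constant.\<close>
  have m: "\<alpha>m t = neg_variation a \<alpha> t + ?\<beta> t + (- \<alpha> a)" if "t \<in> {a..b}" for t
  proof -
    have "\<alpha> t = \<alpha>p t - \<alpha>m t" using dec that by blast
    then show ?thesis by (simp add: pos_variation_def neg_variation_def field_simps)
  qed
  note split_p = rds_integrable_mono_split[OF assms(1) mono(1) \<beta> p rds(1)]
  note split_m = rds_integrable_mono_split[OF assms(1) mono(2) \<beta> m rds(2)]
  show "rds_integrable_mono a b (pos_variation a \<alpha>) f" by (rule split_p(1))
  show "rds_integrable_mono a b (neg_variation a \<alpha>) f" by (rule split_m(1))
  show "lower_rds a b \<alpha>p f - lower_rds a b \<alpha>m f
      = lower_rds a b (pos_variation a \<alpha>) f - lower_rds a b (neg_variation a \<alpha>) f"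
    using split_p(2) split_m(2) by linarith
qed

theorem theorem9p16:
  fixes a b :: real and \<alpha> f :: "real \<Rightarrow> real"
  assumes "a < b"
    and "bounded_variation a b \<alpha>"
    and "bounded (f ` {a..b})"
    and "rds_integrable a b \<alpha> f"
  shows "ls_integrable a b \<alpha> f \<and> rds_integral a b \<alpha> f = ls_integral a b \<alpha> f"
proof
  let ?I = "lower_rds a b (pos_variation a \<alpha>) f - lower_rds a b (neg_variation a \<alpha>) f"
  obtain \<alpha>p \<alpha>m where dec: "rds_decomposition a b \<alpha> f \<alpha>p \<alpha>m"
    using assms(4) by (auto simp: rds_integrable_def)
  note variations = rds_decomposition_variations[OF assms(1,2)]
  have "rds_integral a b \<alpha> f = ?I"
    unfolding rds_integral_def
  \<comment> \<open>The witness is the given decomposition: the variation functions differ by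
    \<alpha> - \<alpha>(a) and so need not decompose \<alpha> themselves. Uniqueness holds because
    every decomposition yields \<open>?I\<close>.\<close>
  proof (rule the_equality)
    show "\<exists>\<alpha>p \<alpha>m. rds_decomposition a b \<alpha> f \<alpha>p \<alpha>m
        \<and> ?I = lower_rds a b \<alpha>p f - lower_rds a b \<alpha>m f"
      using dec variations(3)[OF dec] by metis
  qed (use variations(3) in blast)
  moreover note has_bochner_integral_rds[OF assms(1) variations(1)[OF dec]]
    has_bochner_integral_rds[OF assms(1) variations(2)[OF dec]]
  ultimately show "ls_integrable a b \<alpha> f" "rds_integral a b \<alpha> f = ls_integral a b \<alpha> f"
    by (auto simp: ls_integrable_def ls_integral_def has_bochner_integral_iff)
qed

end
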